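(* Let $X$ be a real Banach space, let $A\subset X$ be nonempty and let $f:X\to\mathbb{R}$ be Lipschitz continuous on a neighborhood of $A$. Then: (1) There is some $\tilde a\in\partial f(A)$ such that $$\inf_{\|h\|\le1}f^0(A;h)=-\min_{a\in\partial f(A)}\|a\|=-\|\tilde a\|.$$ (2) For every pair $(\tilde a,\tilde h)\in\partial f(A)\times\overline{B_1(0)}$ (with $\overline{B_1(0)}\subset X$ the closed unit ball) such that $$\|\tilde a\|=\min_{a\in\partial f(A)}\|a\|\quad\text{and}\quad f^0(A;\tilde h)=\min_{\|h\|\le1}f^0(A;h)\qquad( * )$$ we have $$-\|\tilde a\|=\langle\tilde a,\tilde h\rangle=f^0(A;\tilde h).$$ (3) If $X$ is reflexive, then there exists a pair $(\tilde a,\tilde h)\in\partial f(A)\times\overline{B_1(0)}$ satisfying $( * )$.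
   Context: $X^*$ is the dual of $X$ and $\langle\cdot,\cdot\rangle$ the duality pairing. For $f$ Lipschitz near $x$, Clarke's generalized directional derivative is $f^0(x;h)=\limsup_{y\to x,\,t\downarrow 0}\frac{f(y+th)-f(y)}{t}$ and Clarke's generalized gradient is $\partial f(x)=\{a\in X^*\mid\langle a,h\rangle\le f^0(x;h)\ \forall h\in X\}$. For nonempty $A\subset X$, the gradient of $f$ on $A$ is $\partial f(A):=\overline{\operatorname{conv}}^*\bigcup_{y\in A}\partial f(y)$ (the weak$^*$ closure of the convex hull), and the directional derivative of $f$ on $A$ in direction $h\in X$ is $f^0(A;h):=\sup_{y\in A}f^0(y;h)$. A neighborhood of $A$ is a set containing an open set that contains $A$. *)

theory Defs
  imports "HOL-Analysis.Analysis"
begin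

text \<open>The dual of \<open>X\<close> is \<^typ>\<open>'a \<Rightarrow>\<^sub>L real\<close> with the operator norm, and the duality pairing is
  \<^const>\<open>blinfun_apply\<close>. For real-valued functionals the strong operator topology is the topology of
  pointwise convergence, that is, the weak-star topology.\<close>

abbreviation weak_star_topology :: "('a::real_normed_vector \<Rightarrow>\<^sub>L real) topology"
  where "weak_star_topology \<equiv> strong_operator_topology"

text \<open>Limits superior, suprema and infima are taken in \<^typ>\<open>ereal\<close>, so that they have their
  usual meaning without any boundedness side condition. The base point \<open>y\<close> ranges over
  full neighbourhoods of \<open>x\<close>, so \<open>y = x\<close> is allowed.\<close>

definition clarke_dd :: "('a::real_normed_vector \<Rightarrow> real) \<Rightarrow> 'a \<Rightarrow> 'a \<Rightarrow> ereal"
  where "clarke_dd f x h =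
    Limsup (nhds x \<times>\<^sub>F at_right (0::real)) (\<lambda>(y, t). ereal ((f (y + t *\<^sub>R h) - f y) / t))"

definition clarke_gradient :: "('a::real_normed_vector \<Rightarrow> real) \<Rightarrow> 'a \<Rightarrow> ('a \<Rightarrow>\<^sub>L real) set"
  where "clarke_gradient f x = {a. \<forall>h. ereal (blinfun_apply a h) \<le> clarke_dd f x h}"

definition gradient_on :: "('a::real_normed_vector \<Rightarrow> real) \<Rightarrow> 'a set \<Rightarrow> ('a \<Rightarrow>\<^sub>L real) set"
  where "gradient_on f A =
    weak_star_topology closure_of (convex hull (\<Union>y\<in>A. clarke_gradient f y))"

definition dd_on :: "('a::real_normed_vector \<Rightarrow> real) \<Rightarrow> 'a set \<Rightarrow> 'a \<Rightarrow> ereal"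
  where "dd_on f A h = (SUP y\<in>A. clarke_dd f y h)"

definition bidual_embedding :: "'a::real_normed_vector \<Rightarrow> (('a \<Rightarrow>\<^sub>L real) \<Rightarrow>\<^sub>L real)"
  where "bidual_embedding x = Blinfun (\<lambda>a. blinfun_apply a x)"

lemma bidual_embedding_apply [simp]:
  "blinfun_apply (bidual_embedding x) a = blinfun_apply a x"
  unfolding bidual_embedding_def
  by (simp add: bounded_linear_Blinfun_apply blinfun.bounded_linear_left)

definition reflexive_space :: "'a::real_normed_vector itself \<Rightarrow> bool"
  where "reflexive_space _ \<longleftrightarrow> surj (bidual_embedding :: 'a \<Rightarrow> (('a \<Rightarrow>\<^sub>L real) \<Rightarrow>\<^sub>L real))"

end

theory Submission
  imports Defs
begin

text \<open>The map \<open>p h = f\<^sup>0(A; h)\<close> is sublinear and bounded by \<open>L * norm h\<close>, and by separation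
  in the weak-star topology \<open>\<partial>f(A)\<close> is the set of all functionals dominated by \<open>p\<close>. Every part
  then rests on one form of the Hahn--Banach theorem: if a sublinear \<open>q\<close> is at least \<open>m\<close> on a
  convex set \<open>K\<close>, some linear functional below \<open>q\<close> is still at least \<open>m\<close> on \<open>K\<close>. With \<open>q = p\<close>,
  \<open>K\<close> the unit ball and \<open>m\<close> the infimum of \<open>p\<close> on it, this yields the functional of least norm,
  without weak-star compactness. With \<open>q\<close> the dual norm, \<open>K = \<partial>f(A)\<close> and \<open>m\<close> the least norm,
  it yields an element of the bidual whose negative represents the minimising direction when
  \<open>X\<close> is reflexive.\<close>

section \<open>Sublinear functionals and the Hahn--Banach theorem\<close>

definition sublinear :: "('a::real_vector \<Rightarrow> real) \<Rightarrow> bool"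
  where "sublinear p \<longleftrightarrow>
    (\<forall>x y. p (x + y) \<le> p x + p y) \<and> (\<forall>c x. 0 \<le> c \<longrightarrow> p (c *\<^sub>R x) = c * p x)"

lemma sublinear_add: "sublinear p \<Longrightarrow> p (x + y) \<le> p x + p y"
  by (simp add: sublinear_def)

lemma sublinear_scale: "sublinear p \<Longrightarrow> 0 \<le> c \<Longrightarrow> p (c *\<^sub>R x) = c * p x"
  by (simp add: sublinear_def)

lemma sublinear_0: "sublinear p \<Longrightarrow> p 0 = 0"
  using sublinear_scale[of p 0 0] by simp

lemma sublinear_minus: "sublinear p \<Longrightarrow> - p (- x) \<le> p x"
  using sublinear_add[of p x "- x"] by (simp add: sublinear_0)

text \<open>One inequality gives homogeneity: applied to \<open>inverse c\<close> and
  \<open>c *\<^sub>R x\<close> it yields the reverse one.\<close>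

lemma sublinearI:
  assumes "\<And>x y. p (x + y) \<le> p x + p y" "p 0 = 0"
    and "\<And>c x. 0 < c \<Longrightarrow> p (c *\<^sub>R x) \<le> c * p x"
  shows "sublinear p"
proof -
  have "p (c *\<^sub>R x) = c * p x" if "0 < c" for c x
    using assms(3)[OF that, of x] assms(3)[of "inverse c" "c *\<^sub>R x"] that
    by (simp add: field_simps)
  then have "p (c *\<^sub>R x) = c * p x" if "0 \<le> c" for c x
    using that assms(2) by (cases "c = 0") auto
  then show ?thesis using assms(1) by (simp add: sublinear_def)
qed

lemma sublinear_norm: "sublinear norm"
  by (simp add: sublinear_def norm_triangle_ineq)

text \<open>The witness is the infimum of \<open>q (x + t *\<^sub>R k) - t * m\<close> over
  \<open>0 \<le> t\<close> and \<open>k \<in> K\<close>: the choice \<open>t = 0\<close> gives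
  \<open>r \<le> q\<close>, and \<open>t = 1\<close> at \<open>- k\<close> gives
  \<open>r (- k) \<le> q 0 - m = - m\<close>. The hypothesis \<open>m \<le> q k\<close> keeps the
  infimum finite; convexity of \<open>K\<close> gives subadditivity.\<close>

lemma sublinear_lower_on_convex:
  assumes q: "sublinear q" and K: "convex K" "K \<noteq> {}" and m: "\<And>k. k \<in> K \<Longrightarrow> m \<le> q k"
  obtains r where "sublinear r" "\<And>x. r x \<le> q x" "\<And>k. k \<in> K \<Longrightarrow> r (- k) \<le> - m"
proof -
  \<comment> \<open>The cone generated by \<open>{1} \<times> K\<close>; the first coordinate
    records which multiple of \<open>m\<close> to subtract.\<close>
  define T where "T = {(t, t *\<^sub>R k) |t k. 0 \<le> t \<and> k \<in> K}"
  define v where "v x = (\<lambda>(t, z). q (x + z) - t * m)" for x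
  define r where "r x = (INF w\<in>T. v x w)" for x
  have T0: "(0, 0) \<in> T"
    using K(2) by (force simp: T_def)
  have T_scale: "(c * t, c *\<^sub>R z) \<in> T" if "(t, z) \<in> T" "0 < c" for c t z
    using that by (force simp: T_def)
  have T_add: "(t + s, y + z) \<in> T" if tz: "(t, y) \<in> T" "(s, z) \<in> T" for t s y z
  proof -
    obtain k l where kl: "k \<in> K" "l \<in> K" "y = t *\<^sub>R k" "z = s *\<^sub>R l" "0 \<le> t" "0 \<le> s"
      using tz unfolding T_def by blast
    show ?thesis
    proof (cases "t + s = 0")
      case True
      then show ?thesis using kl T0 by (simp add: add_nonneg_eq_0_iff)
    next
      case False
      then have pos: "0 < t + s" using kl by linarith
      \<comment> \<open>The sum of two multiples of points of \<open>K\<close> is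
        \<open>t + s\<close> times their weighted mean, which lies in \<open>K\<close> by
        convexity.\<close>
      let ?j = "(t / (t + s)) *\<^sub>R k + (s / (t + s)) *\<^sub>R l"
      have "?j \<in> K"
        by (rule convexD[OF K(1) kl(1,2)]) (use kl pos in \<open>auto simp flip: add_divide_distrib\<close>)
      moreover have "y + z = (t + s) *\<^sub>R ?j"
        using pos kl by (simp add: scaleR_add_right)
      ultimately show ?thesis
        unfolding T_def using pos by force
    qed
  qed
  have lower: "- q (- x) \<le> v x w" if "w \<in> T" for x w
  proof -
    obtain t k where w: "w = (t, t *\<^sub>R k)" "0 \<le> t" "k \<in> K" using \<open>w \<in> T\<close> by (auto simp: T_def)
    have "t * m \<le> q (t *\<^sub>R k)"
      using w m by (simp add: sublinear_scale[OF q] mult_left_mono)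
    also have "\<dots> \<le> q (x + t *\<^sub>R k) + q (- x)"
      using sublinear_add[OF q, of "x + t *\<^sub>R k" "- x"] by simp
    finally show ?thesis by (simp add: w v_def)
  qed
  have r_le: "r x \<le> v x w" if "w \<in> T" for x w
    unfolding r_def using that lower by (intro cINF_lower bdd_belowI2[where m = "- q (- x)"]) auto
  have r_ge: "c \<le> r x" if "\<And>t z. (t, z) \<in> T \<Longrightarrow> c \<le> v x (t, z)" for c x
    unfolding r_def using that T0 by (intro cINF_greatest) auto
  have r_q: "r x \<le> q x" for x
    using r_le[OF T0, of x] by (simp add: v_def)
  have "sublinear r"
  proof (rule sublinearI)
    show "r 0 = 0"
    proof (rule antisym)
      show "r 0 \<le> 0" using r_q[of 0] by (simp add: sublinear_0[OF q])
      show "0 \<le> r 0" by (rule r_ge) (use lower[of _ 0] in \<open>simp add: sublinear_0[OF q]\<close>)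
    qed
    show "r (x + y) \<le> r x + r y" for x y
    proof -
      \<comment> \<open>The two infima are taken one after the other, first over
        \<open>(s, w)\<close> and then over \<open>(t, z)\<close>.\<close>
      have "r (x + y) - v x (t, z) \<le> v y (s, w)" if "(t, z) \<in> T" "(s, w) \<in> T" for t z s w
        using r_le[OF T_add[OF that], of "x + y"] sublinear_add[OF q, of "x + z" "y + w"]
        by (simp add: v_def algebra_simps)
      then have "r (x + y) - v x (t, z) \<le> r y" if "(t, z) \<in> T" for t z
        using that by (intro r_ge)
      then have "r (x + y) - r y \<le> r x"
        by (intro r_ge) (simp add: algebra_simps)
      then show ?thesis by simp
    qed
    show "r (c *\<^sub>R x) \<le> c * r x" if "0 < c" for c x
    proof -
      have "r (c *\<^sub>R x) / c \<le> v x (t, z)" if "(t, z) \<in> T" for t z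
        using r_le[OF T_scale[OF that \<open>0 < c\<close>], of "c *\<^sub>R x"] sublinear_scale[OF q, of c "x + z"]
          \<open>0 < c\<close> by (simp add: v_def field_simps scaleR_add_right)
      then have "r (c *\<^sub>R x) / c \<le> r x" by (rule r_ge)
      then show ?thesis using that by (simp add: field_simps)
    qed
  qed
  moreover have "r (- k) \<le> - m" if "k \<in> K" for k
  proof -
    have "(1, 1 *\<^sub>R k) \<in> T" unfolding T_def using that by force
    from r_le[OF this, of "- k"] show ?thesis by (simp add: v_def sublinear_0[OF q])
  qed
  ultimately show ?thesis using that r_q by blast
qed

text \<open>A minimal sublinear functional is linear, because lowering it at a point \<open>- x\<close> by
  \<open>sublinear_lower_on_convex\<close> with \<open>K = {x}\<close> cannot change it.\<close>

lemma linear_below_sublinear: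
  assumes p: "sublinear p"
  obtains a where "linear a" "\<And>x. a x \<le> p x"
proof -
  define S where "S = {q. sublinear q \<and> q \<le> p}"
  have "\<exists>m\<in>S. \<forall>q\<in>S. q \<le> m \<longrightarrow> q = m"
  proof (rule predicate_Zorn)
    \<comment> \<open>The order is reversed, so the maximal element supplied by Zorn's lemma is a
      minimal functional.\<close>
    show "partial_order_on S (relation_of (\<lambda>x y. y \<le> x) S)"
      by (rule partial_order_on_relation_ofI) auto
    fix C assume C: "C \<in> Chains (relation_of (\<lambda>x y. y \<le> x) S)"
    have CS: "C \<subseteq> S" and tot: "\<And>q r. q \<in> C \<Longrightarrow> r \<in> C \<Longrightarrow> q \<le> r \<or> r \<le> q"
      using C by (auto simp: Chains_def relation_of_def)
    show "\<exists>u\<in>S. \<forall>q\<in>C. u \<le> q"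
    proof (cases "C = {}")
      case True
      then show ?thesis using p by (auto simp: S_def)
    next
      case False
      \<comment> \<open>The pointwise infimum of the chain is finite because every member is at
        least \<open>- p (- x)\<close> at \<open>x\<close>.\<close>
      define u where "u x = (INF q\<in>C. q x)" for x
      have sub: "sublinear q" "q x \<le> p x" if "q \<in> C" for q x
        using that CS by (auto simp: S_def le_fun_def)
      have "- p (- x) \<le> q x" if "q \<in> C" for q x
        using sublinear_minus[OF sub(1)[OF that], of x] sub(2)[OF that, of "- x"] by linarith
      then have u_le: "u x \<le> q x" if "q \<in> C" for q x
        unfolding u_def using that
        by (intro cINF_lower bdd_belowI2[where m = "- p (- x)"]) auto
      have u_ge: "c \<le> u x" if "\<And>q. q \<in> C \<Longrightarrow> c \<le> q x" for c x
        unfolding u_def using that False by (intro cINF_greatest) auto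
      have "sublinear u"
      proof (rule sublinearI)
        have "u 0 = (INF q\<in>C. 0)"
          unfolding u_def by (intro INF_cong refl sublinear_0 sub(1))
        then show "u 0 = 0" using False by simp
        show "u (x + y) \<le> u x + u y" for x y
        proof -
          \<comment> \<open>Members of a chain are comparable, so subadditivity of the smaller of
            \<open>q\<close> and \<open>r\<close> gives the bound.\<close>
          have "u (x + y) - q x \<le> r y" if "q \<in> C" "r \<in> C" for q r
            using tot[OF that] that u_le[of _ "x + y"] sub(1) sublinear_add
            by (smt (verit, best) le_fun_def)
          then have "u (x + y) - q x \<le> u y" if "q \<in> C" for q
            using that by (intro u_ge)
          then have "u (x + y) - u y \<le> u x"
            by (intro u_ge) (simp add: algebra_simps)
          then show ?thesis by simp
        qed
        show "u (c *\<^sub>R x) \<le> c * u x" if "0 < c" for c x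
        proof -
          have "u (c *\<^sub>R x) / c \<le> q x" if "q \<in> C" for q
            using u_le[OF that, of "c *\<^sub>R x"] sublinear_scale[OF sub(1)[OF that], of c x] \<open>0 < c\<close>
            by (simp add: field_simps)
          then have "u (c *\<^sub>R x) / c \<le> u x" by (rule u_ge)
          then show ?thesis using that by (simp add: field_simps)
        qed
      qed
      moreover have "u \<le> p"
        using False u_le sub(2) by (meson ex_in_conv le_funI order_trans)
      ultimately show ?thesis using u_le by (auto simp: S_def le_fun_def)
    qed
  qed
  \<comment> \<open>A sublinear functional below \<open>a\<close> is also below \<open>p\<close> and
    hence in \<open>S\<close>, so minimality in \<open>S\<close> is minimality among all sublinear
    functionals.\<close>
  then obtain a where a: "sublinear a" "a \<le> p"
    and min: "\<And>q. sublinear q \<Longrightarrow> q \<le> a \<Longrightarrow> q = a"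
    unfolding S_def by (metis (mono_tags, lifting) mem_Collect_eq order_trans)
  have neg: "a (- x) = - a x" for x
  proof -
    obtain r where "sublinear r" "\<And>y. r y \<le> a y" "\<And>k. k \<in> {x} \<Longrightarrow> r (- k) \<le> - a x"
      using sublinear_lower_on_convex[OF a(1), of "{x}" "a x"] by auto
    then have "a (- x) \<le> - a x" using min[of r] by (auto simp: le_fun_def)
    then show ?thesis using sublinear_minus[OF a(1), of x] by simp
  qed
  have "linear a"
  proof (rule linearI)
    show "a (x + y) = a x + a y" for x y
      using sublinear_add[OF a(1), of x y] sublinear_add[OF a(1), of "- x" "- y"] neg[of "x + y"]
      by (simp add: neg)
    show "a (c *\<^sub>R x) = c *\<^sub>R a x" for c x
      using sublinear_scale[OF a(1), of c x] sublinear_scale[OF a(1), of "- c" x] neg[of "c *\<^sub>R x"]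
      by (cases "0 \<le> c") auto
  qed
  then show ?thesis using that a(2) by (auto simp: le_fun_def)
qed

text \<open>A linear \<open>a\<close> below the lowered functional \<open>r\<close> satisfies
  \<open>a k = - a (- k) \<ge> - r (- k) \<ge> m\<close>.\<close>

theorem sublinear_sandwich_convex:
  assumes "sublinear p" "convex K" "K \<noteq> {}" "\<And>k. k \<in> K \<Longrightarrow> m \<le> p k"
  obtains a where "linear a" "\<And>x. a x \<le> p x" "\<And>k. k \<in> K \<Longrightarrow> m \<le> a k"
proof -
  obtain r where r: "sublinear r" "\<And>x. r x \<le> p x" "\<And>k. k \<in> K \<Longrightarrow> r (- k) \<le> - m"
    using sublinear_lower_on_convex[OF assms] by blast
  obtain a where a: "linear a" "\<And>x. a x \<le> r x"
    using linear_below_sublinear[OF r(1)] by blast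
  have "m \<le> a k" if "k \<in> K" for k
    using a(2)[of "- k"] r(3)[OF that] by (simp add: linear_neg[OF a(1)])
  then show ?thesis using that a r(2) by (meson order_trans)
qed

section \<open>Continuous functionals dominated by a sublinear functional, and weak-star
  closures\<close>

text \<open>For sublinear \<open>p\<close> this is the subdifferential of \<open>p\<close> at
  0.\<close>

definition dominated :: "('a::real_normed_vector \<Rightarrow> real) \<Rightarrow> ('a \<Rightarrow>\<^sub>L real) set"
  where "dominated p = {a. \<forall>h. blinfun_apply a h \<le> p h}"

lemma convex_dominated: "convex (dominated p)"
proof (rule convexI)
  fix a b and u v :: real
  assume ab: "a \<in> dominated p" "b \<in> dominated p" and uv: "0 \<le> u" "0 \<le> v" "u + v = 1"
  show "u *\<^sub>R a + v *\<^sub>R b \<in> dominated p"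
    unfolding dominated_def
  proof (clarsimp simp: blinfun.add_left blinfun.scaleR_left)
    fix h
    have "u * blinfun_apply a h + v * blinfun_apply b h \<le> u * p h + v * p h"
      using ab uv by (intro add_mono mult_left_mono) (auto simp: dominated_def)
    also have "\<dots> = p h" using uv by (simp flip: distrib_right)
    finally show "u * blinfun_apply a h + v * blinfun_apply b h \<le> p h" .
  qed
qed

lemma norm_dominated_le:
  assumes "\<And>h. p h \<le> L * norm h" "0 \<le> L" "a \<in> dominated p"
  shows "norm a \<le> L"
proof (rule norm_blinfun_bound[OF \<open>0 \<le> L\<close>])
  fix h
  show "norm (blinfun_apply a h) \<le> L * norm h"
    using assms(1)[of h] assms(1)[of "- h"] assms(3)[unfolded dominated_def, simplified, rule_format]
    by (smt (verit) blinfun.minus_right norm_minus_cancel real_norm_def)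
qed

text \<open>The bound \<open>L * norm h\<close>, used at \<open>x\<close> and at \<open>- x\<close>,
  makes the linear functional of the sandwich theorem continuous.\<close>

lemma dominated_sandwich_convex:
  fixes p :: "'a::real_normed_vector \<Rightarrow> real"
  assumes p: "sublinear p" "\<And>h. p h \<le> L * norm h"
    and K: "convex K" "K \<noteq> {}" "\<And>k. k \<in> K \<Longrightarrow> m \<le> p k"
  obtains a where "a \<in> dominated p" "\<And>k. k \<in> K \<Longrightarrow> m \<le> blinfun_apply a k"
proof -
  obtain b where b: "linear b" "\<And>x. b x \<le> p x" "\<And>k. k \<in> K \<Longrightarrow> m \<le> b k"
    using sublinear_sandwich_convex[OF p(1) K] by blast
  have "norm (b x) \<le> norm x * L" for x
    using b(2)[of x] p(2)[of x] b(2)[of "- x"] p(2)[of "- x"]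
    by (simp add: linear_neg[OF b(1)] abs_le_iff mult.commute)
  then have "bounded_linear b"
    using b(1) by (auto simp: bounded_linear_def bounded_linear_axioms_def)
  then have "blinfun_apply (Blinfun b) = b"
    by (rule bounded_linear_Blinfun_apply)
  then show ?thesis using that[of "Blinfun b"] b by (simp add: dominated_def)
qed

text \<open>Taking \<open>K = {h}\<close> and \<open>m = p h\<close> shows that \<open>p\<close> is
  the support function of \<open>dominated p\<close>, with the supremum attained in every
  direction.\<close>

lemma dominated_attains:
  fixes p :: "'a::real_normed_vector \<Rightarrow> real"
  assumes "sublinear p" "\<And>h. p h \<le> L * norm h"
  obtains a where "a \<in> dominated p" "blinfun_apply a h = p h"
proof -
  obtain a where "a \<in> dominated p" "\<And>k. k \<in> {h} \<Longrightarrow> p h \<le> blinfun_apply a k"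
    using dominated_sandwich_convex[OF assms, of "{h}" "p h"] by auto
  then show ?thesis using that[of a] by (simp add: dominated_def order_antisym)
qed

text \<open>The separating vector is a near-minimiser of the sum of squared distances of the
  coordinates: the first-order condition at it holds up to an arbitrarily small error, which is
  harmless since the infimum is positive.\<close>

lemma weak_star_separation:
  fixes S :: "('a::real_normed_vector \<Rightarrow>\<^sub>L real) set"
  assumes S: "convex S" "S \<noteq> {}" "\<And>s. s \<in> S \<Longrightarrow> norm s \<le> L"
    and a: "a \<notin> weak_star_topology closure_of S"
  obtains h e where "0 < e" "\<And>s. s \<in> S \<Longrightarrow> blinfun_apply s h \<le> blinfun_apply a h - e"
proof -
  obtain G where G: "openin weak_star_topology G" "a \<in> G" "G \<inter> S = {}"
    using a by (auto simp: in_closure_of strong_operator_topology_topspace)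
  \<comment> \<open>Shrinking \<open>G\<close> to a basic neighbourhood of \<open>a\<close> leaves
    conditions at finitely many vectors only.\<close>
  obtain I d where I: "finite I" "0 < d"
    and near: "\<And>s. (\<And>x. x \<in> I \<Longrightarrow> \<bar>blinfun_apply s x - blinfun_apply a x\<bar> < d) \<Longrightarrow> s \<in> G"
  proof -
    obtain V where V: "open V" "G = blinfun_apply -` V"
      using G(1) by (auto simp: strong_operator_topology_def openin_pullback_topology)
    then obtain U where U: "blinfun_apply a \<in> Pi\<^sub>E UNIV U" "\<And>i. open (U i)"
      "finite {i. U i \<noteq> UNIV}" "Pi\<^sub>E UNIV U \<subseteq> V"
      using product_topology_open_contains_basis[of "\<lambda>_. euclidean" UNIV V "blinfun_apply a"] G(2)
      by (auto simp: euclidean_product_topology)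
    have "\<exists>e>0. \<forall>y. \<bar>y - blinfun_apply a i\<bar> < e \<longrightarrow> y \<in> U i" for i
      using U(1,2) by (metis PiE_UNIV_domain Pi_iff UNIV_I dist_real_def open_dist)
    then obtain e where e: "\<And>i. 0 < e i" "\<And>i y. \<bar>y - blinfun_apply a i\<bar> < e i \<Longrightarrow> y \<in> U i"
      by metis
    let ?I = "{i. U i \<noteq> UNIV}"
    \<comment> \<open>The entry 1 keeps the minimum defined and positive when no coordinate is
      restricted.\<close>
    let ?d = "Min (insert 1 (e ` ?I))"
    show ?thesis
    proof (rule that[of ?I ?d])
      show "0 < ?d" using U(3) e(1) by (subst Min_gr_iff) auto
      fix s assume s: "\<And>x. x \<in> ?I \<Longrightarrow> \<bar>blinfun_apply s x - blinfun_apply a x\<bar> < ?d"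
      have "blinfun_apply s x \<in> U x" for x
      proof (cases "x \<in> ?I")
        case True
        then have "?d \<le> e x" using U(3) by (intro Min_le) auto
        then show ?thesis using s[OF True] by (intro e(2)) linarith
      qed auto
      then show "s \<in> G" using U(4) V(2) by auto
    qed (use U(3) in auto)
  qed
  define Q where "Q s = (\<Sum>x\<in>I. (blinfun_apply s x - blinfun_apply a x)\<^sup>2)" for s
  have far: "d\<^sup>2 \<le> Q s" if "s \<in> S" for s
  proof -
    obtain x where x: "x \<in> I" "d \<le> \<bar>blinfun_apply s x - blinfun_apply a x\<bar>"
      using near[of s] G(3) \<open>s \<in> S\<close> by force
    then have "d\<^sup>2 \<le> (blinfun_apply s x - blinfun_apply a x)\<^sup>2"
      using I(2) by (metis abs_ge_zero abs_of_pos power2_abs power_mono less_imp_le)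
    also have "\<dots> \<le> Q s"
      unfolding Q_def using x(1) I(1) by (intro member_le_sum) auto
    finally show ?thesis .
  qed
  \<comment> \<open>As \<open>S\<close> is bounded in norm, \<open>M\<close> bounds the second-order
    term of \<open>Q\<close> along all segments in \<open>S\<close>.\<close>
  define M where "M = (\<Sum>x\<in>I. (2 * L * norm x)\<^sup>2)"
  have M: "(\<Sum>x\<in>I. (blinfun_apply s x - blinfun_apply r x)\<^sup>2) \<le> M" if "s \<in> S" "r \<in> S" for s r
    unfolding M_def
  proof (rule sum_mono)
    fix x
    have "\<bar>blinfun_apply s x\<bar> \<le> L * norm x" "\<bar>blinfun_apply r x\<bar> \<le> L * norm x"
      using norm_blinfun[of s x] norm_blinfun[of r x]
        mult_right_mono[OF S(3)[OF that(1)], of "norm x"]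
        mult_right_mono[OF S(3)[OF that(2)], of "norm x"] by auto
    then have "\<bar>blinfun_apply s x - blinfun_apply r x\<bar> \<le> \<bar>2 * L * norm x\<bar>" by linarith
    then show "(blinfun_apply s x - blinfun_apply r x)\<^sup>2 \<le> (2 * L * norm x)\<^sup>2"
      by (simp add: abs_le_square_iff)
  qed
  have "0 \<le> M" by (simp add: M_def sum_nonneg)
  \<comment> \<open>The bound 1 keeps the step from \<open>r\<close> towards \<open>s\<close> inside
    \<open>S\<close>. The other bound makes the error \<open>t * (1 + M)\<close> at most
    \<open>d\<^sup>2\<close>; this error is what remains of the tolerance \<open>t\<^sup>2\<close>
    and the second-order term after division by \<open>t\<close>.\<close>
  define t where "t = min 1 (d\<^sup>2 / (1 + M))"
  have t: "0 < t" "t \<le> 1" "t \<le> d\<^sup>2 / (1 + M)"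
    using I(2) \<open>0 \<le> M\<close> by (auto simp: t_def)
  then have t_M: "t * (1 + M) \<le> d\<^sup>2"
    using \<open>0 \<le> M\<close> by (simp add: pos_le_divide_eq)
  have bdd: "bdd_below (Q ` S)"
    by (rule bdd_belowI2[where m = 0]) (simp add: Q_def sum_nonneg)
  obtain r where r: "r \<in> S" "Q r < (INF s\<in>S. Q s) + t\<^sup>2"
    using cInf_lessD[of "Q ` S" "(INF s\<in>S. Q s) + t\<^sup>2"] S(2) t(1) by auto
  define v where "v x = blinfun_apply r x - blinfun_apply a x" for x
  \<comment> \<open>The derivative of \<open>Q\<close> at \<open>r\<close> in a direction
    \<open>u\<close> is \<open>- 2 * blinfun_apply u h\<close>.\<close>
  define h where "h = - (\<Sum>x\<in>I. v x *\<^sub>R x)"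
  have h: "blinfun_apply b h = - (\<Sum>x\<in>I. v x * blinfun_apply b x)" for b
    by (simp add: h_def blinfun.minus_right blinfun.sum_right blinfun.scaleR_right)
  show ?thesis
  proof (rule that[of "d\<^sup>2 / 2" h])
    fix s assume s: "s \<in> S"
    define w where "w x = blinfun_apply s x - blinfun_apply r x" for x
    have "(1 - t) *\<^sub>R r + t *\<^sub>R s \<in> S"
      using S(1) r(1) s t by (intro convexD) auto
    then have "(INF s\<in>S. Q s) \<le> Q ((1 - t) *\<^sub>R r + t *\<^sub>R s)"
      using bdd by (intro cINF_lower)
    then have "Q r - t\<^sup>2 < Q ((1 - t) *\<^sub>R r + t *\<^sub>R s)" using r(2) by simp
    also have "\<dots> = (\<Sum>x\<in>I. (v x + t * w x)\<^sup>2)"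
      by (simp add: Q_def v_def w_def blinfun.add_left blinfun.scaleR_left left_diff_distrib
          right_diff_distrib)
        (simp add: algebra_simps)
    also have "\<dots> = Q r + 2 * t * (\<Sum>x\<in>I. v x * w x) + t\<^sup>2 * (\<Sum>x\<in>I. (w x)\<^sup>2)"
      by (simp add: Q_def v_def[symmetric] power2_sum power_mult_distrib sum.distrib
          sum_distrib_left algebra_simps)
    also have "\<dots> \<le> Q r + 2 * t * (\<Sum>x\<in>I. v x * w x) + t\<^sup>2 * M"
      using M[OF s r(1)] by (simp add: w_def mult_left_mono)
    finally have "t * (- (t * (1 + M))) < t * (2 * (\<Sum>x\<in>I. v x * w x))"
      by (simp add: algebra_simps power2_eq_square)
    then have "- (t * (1 + M)) < 2 * (\<Sum>x\<in>I. v x * w x)"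
      using t(1) by (simp only: mult_less_cancel_left_pos)
    then have "- d\<^sup>2 / 2 \<le> (\<Sum>x\<in>I. v x * w x)" using t_M by simp
    moreover have "d\<^sup>2 \<le> (\<Sum>x\<in>I. v x * v x)"
      using far[OF r(1)] by (simp add: Q_def v_def power2_eq_square)
    \<comment> \<open>The coordinates of \<open>s - a\<close> are \<open>v x + w x\<close>, so the
      difference is at least \<open>d\<^sup>2 - d\<^sup>2 / 2\<close>.\<close>
    moreover have "blinfun_apply a h - blinfun_apply s h = (\<Sum>x\<in>I. v x * v x) + (\<Sum>x\<in>I. v x * w x)"
      by (simp add: h w_def v_def sum.distrib[symmetric] sum_subtractf[symmetric] algebra_simps)
    ultimately show "blinfun_apply s h \<le> blinfun_apply a h - d\<^sup>2 / 2" by simp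
  qed (use I(2) in auto)
qed


text \<open>Assumption \<open>lub\<close> makes \<open>p\<close> the pointwise supremum of the
  \<open>P y\<close>. One inclusion holds because \<open>dominated p\<close> is convex and weak-star
  closed. For the other, a functional \<open>a\<close> outside the closure is separated by some
  \<open>h\<close>; since every value \<open>P y h\<close> is attained, \<open>p h\<close> would lie
  strictly below \<open>blinfun_apply a h\<close>.\<close>

lemma weak_star_closure_convex_hull_dominated:
  fixes P :: "'i \<Rightarrow> 'a::real_normed_vector \<Rightarrow> real"
  assumes A: "A \<noteq> {}" and P: "\<And>y. y \<in> A \<Longrightarrow> sublinear (P y)" "\<And>y h. y \<in> A \<Longrightarrow> P y h \<le> L * norm h"
    and L: "0 \<le> L"
    and lub: "\<And>h c. p h \<le> c \<longleftrightarrow> (\<forall>y\<in>A. P y h \<le> c)"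
  shows "weak_star_topology closure_of (convex hull (\<Union>y\<in>A. dominated (P y))) = dominated p"
    (is "_ closure_of ?S = _")
proof
  have P_le: "P y h \<le> p h" if "y \<in> A" for y h
    using lub[of h "p h"] that by simp
  have S_sub: "?S \<subseteq> dominated p"
  proof (rule hull_minimal)
    show "(\<Union>y\<in>A. dominated (P y)) \<subseteq> dominated p"
      using P_le by (fastforce simp: dominated_def intro: order_trans)
  qed (rule convex_dominated)
  have "closedin weak_star_topology {a. blinfun_apply a h \<le> p h}" for h
    using closedin_continuous_map_preimage[OF strong_operator_topology_continuous_evaluation[of h],
        of "{..p h}"] by (simp add: strong_operator_topology_topspace)
  then have "closedin weak_star_topology (\<Inter>h. {a. blinfun_apply a h \<le> p h})"
    by (intro closedin_Inter) auto
  moreover have "(\<Inter>h. {a. blinfun_apply a h \<le> p h}) = dominated p"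
    by (auto simp: dominated_def)
  ultimately show "weak_star_topology closure_of ?S \<subseteq> dominated p"
    by (intro closure_of_minimal[OF S_sub]) simp
  show "dominated p \<subseteq> weak_star_topology closure_of ?S"
  proof (rule ccontr)
    assume "\<not> ?thesis"
    then obtain a where a: "a \<in> dominated p" "a \<notin> weak_star_topology closure_of ?S" by auto
    have p_le: "p h \<le> L * norm h" for h using lub P(2) by blast
    obtain y where y: "y \<in> A" using A by auto
    then obtain b where "b \<in> dominated (P y)" using dominated_attains P by metis
    then have "?S \<noteq> {}" using y by auto
    moreover have "norm s \<le> L" if "s \<in> ?S" for s
      using norm_dominated_le[of p L s] p_le L that S_sub by blast
    ultimately obtain h e where he: "0 < e"
      "\<And>s. s \<in> ?S \<Longrightarrow> blinfun_apply s h \<le> blinfun_apply a h - e"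
      using weak_star_separation[OF convex_convex_hull _ _ a(2)] by metis
    have "P y h \<le> blinfun_apply a h - e" if y: "y \<in> A" for y
    proof -
      obtain s where "s \<in> dominated (P y)" "blinfun_apply s h = P y h"
        using dominated_attains[OF P(1)[OF y] P(2)[OF y]] .
      then show ?thesis
        using he(2)[of s] y by (auto intro: hull_inc)
    qed
    then have "p h \<le> blinfun_apply a h - e" using lub by simp
    then show False using a(1) he(1) by (auto simp: dominated_def dest: spec[of _ h])
  qed
qed

section \<open>Least norms and lower bounds on the unit ball\<close>

text \<open>The ball is symmetric: the bounds at \<open>sgn h\<close> and \<open>- sgn h\<close>
  together control the absolute value.\<close>

lemma norm_blinfun_le_if_cball_lower:
  assumes "\<And>k. k \<in> cball 0 1 \<Longrightarrow> m \<le> blinfun_apply a k"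
  shows "norm a \<le> - m"
proof (rule norm_blinfun_bound)
  show "0 \<le> - m" using assms[of 0] by simp
  fix h
  show "norm (blinfun_apply a h) \<le> - m * norm h"
  proof (cases "h = 0")
    case False
    have "m \<le> blinfun_apply a (c *\<^sub>R sgn h)" if "\<bar>c\<bar> = 1" for c
      using that by (intro assms) (simp add: norm_sgn)
    from this[of 1] this[of "- 1"] show ?thesis
      using False
      by (simp add: sgn_div_norm blinfun.scaleR_right blinfun.minus_right abs_le_iff field_simps)
  qed simp
qed

lemma blinfun_cball_ge:
  assumes "k \<in> cball 0 1"
  shows "- norm a \<le> blinfun_apply a k"
proof -
  have "\<bar>blinfun_apply a k\<bar> \<le> norm a * norm k" using norm_blinfun[of a k] by simp
  also have "\<dots> \<le> norm a" using assms by (simp add: mult_left_le)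
  finally show ?thesis by linarith
qed

text \<open>Sandwiching with the unit ball and the infimum \<open>m\<close> of \<open>p\<close> on
  it gives \<open>a\<close> at least \<open>m\<close> on the ball, so
  \<open>norm a \<le> - m\<close>. As \<open>- norm a\<close> is itself a lower bound of
  \<open>p\<close> on the ball, the second conclusion makes it the greatest one.\<close>

lemma dominated_minimal_norm:
  fixes p :: "'a::real_normed_vector \<Rightarrow> real"
  assumes p: "sublinear p" "\<And>h. p h \<le> L * norm h" and L: "0 \<le> L"
  obtains a where "a \<in> dominated p"
    and "\<And>c. (\<And>h. h \<in> cball 0 1 \<Longrightarrow> c \<le> p h) \<Longrightarrow> c \<le> - norm a"
proof -
  define m where "m = (INF h\<in>cball 0 1. p h)"
  have "- L \<le> p h" if "h \<in> cball 0 1" for h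
    using sublinear_minus[OF p(1), of h] p(2)[of "- h"] mult_left_le[of "norm h" L] that L by simp
  then have "bdd_below (p ` cball 0 1)" by (intro bdd_belowI2)
  then have "m \<le> p h" if "h \<in> cball 0 1" for h
    unfolding m_def using that by (rule cINF_lower)
  then obtain a where a: "a \<in> dominated p" "\<And>k. k \<in> cball 0 1 \<Longrightarrow> m \<le> blinfun_apply a k"
    using dominated_sandwich_convex[OF p convex_cball, of 0 1 m] by auto
  have "c \<le> - norm a" if "\<And>h. h \<in> cball 0 1 \<Longrightarrow> c \<le> p h" for c
  proof -
    have "c \<le> m" unfolding m_def using that by (intro cINF_greatest) auto
    then show ?thesis using norm_blinfun_le_if_cball_lower[of m a] a(2) by force
  qed
  then show ?thesis using that a(1) by blast
qed

text \<open>The sandwich theorem is applied in the dual space to the dual norm. By reflexivity the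
  resulting \<open>\<Phi>\<close> is evaluation at some \<open>x\<close>, and
  \<open>h = - x\<close>.\<close>

lemma reflexive_separation_from_ball:
  fixes K :: "('a::real_normed_vector \<Rightarrow>\<^sub>L real) set"
  assumes refl: "reflexive_space TYPE('a)"
    and K: "convex K" "K \<noteq> {}" "\<And>b. b \<in> K \<Longrightarrow> m \<le> norm b"
  obtains h where "h \<in> cball 0 1" "\<And>b. b \<in> K \<Longrightarrow> blinfun_apply b h \<le> - m"
proof -
  obtain \<Phi> where \<Phi>: "\<Phi> \<in> dominated norm" "\<And>b. b \<in> K \<Longrightarrow> m \<le> blinfun_apply \<Phi> b"
    using dominated_sandwich_convex[OF sublinear_norm, of 1 K m] K by auto
  obtain x where x: "\<Phi> = bidual_embedding x"
    using refl unfolding reflexive_space_def by (metis surjD)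
  \<comment> \<open>A norming functional for \<open>x\<close> turns the domination of
    \<open>\<Phi>\<close> by the norm into \<open>norm x \<le> 1\<close>.\<close>
  obtain b where b: "b \<in> dominated norm" "blinfun_apply b x = norm x"
    using dominated_attains[OF sublinear_norm, of 1 x] by auto
  have "norm x = blinfun_apply \<Phi> b" by (simp add: x b)
  also have "\<dots> \<le> norm b" using \<Phi>(1) by (simp add: dominated_def)
  also have "\<dots> \<le> 1" using norm_dominated_le[OF _ _ b(1), of 1] by simp
  finally have "- x \<in> cball 0 1" by simp
  moreover have "blinfun_apply b (- x) \<le> - m" if "b \<in> K" for b
    using \<Phi>(2)[OF that] by (simp add: x blinfun.minus_right)
  ultimately show ?thesis using that by blast
qed

section \<open>The Clarke directional derivative as a sublinear functional\<close>

text \<open>The image of \<open>F\<close> under \<open>\<phi>\<close> is finer than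
  \<open>G\<close>, so the limit superior can only decrease. This serves to rescale the step
  \<open>t\<close> in \<open>clarke_dd\<close>.\<close>

lemma Limsup_compose_le:
  fixes g :: "_ \<Rightarrow> _ :: complete_linorder"
  assumes "filterlim \<phi> G F"
  shows "Limsup F (\<lambda>x. g (\<phi> x)) \<le> Limsup G g"
  unfolding Limsup_le_iff
  using Limsup_lessD assms unfolding filterlim_iff by blast

context
  fixes f :: "'a::real_normed_vector \<Rightarrow> real" and U :: "'a set" and L :: real and x :: 'a
  assumes lip: "open U" "x \<in> U" "L-lipschitz_on U f"
begin

private abbreviation "F \<equiv> nhds x \<times>\<^sub>F at_right (0::real)"

private lemma filterlim_fst_F: "filterlim fst (nhds x) F"
  by (simp add: filterlim_def filtermap_fst_prod_filter)

private lemma filterlim_snd_F: "filterlim snd (at_right 0) F"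
  by (simp add: filterlim_def filtermap_snd_prod_filter)

private lemma filterlim_step_F: "filterlim (\<lambda>w. fst w + snd w *\<^sub>R h) (nhds x) F"
proof -
  have "(snd \<longlongrightarrow> 0) F"
    using filterlim_snd_F by (rule filterlim_mono) (auto simp: at_within_def)
  from tendsto_add[OF filterlim_fst_F tendsto_scaleR[OF this tendsto_const[of h]]]
  show ?thesis by simp
qed

text \<open>Base point and shifted point eventually lie in \<open>U\<close>, where the Lipschitz
  constant bounds the difference quotient. The derivative is therefore finite, and computations can
  pass to the reals.\<close>

lemma clarke_dd_bounds:
  "ereal (- (L * norm h)) \<le> clarke_dd f x h" "clarke_dd f x h \<le> ereal (L * norm h)"
proof -
  have "\<forall>\<^sub>F w in F. fst w \<in> U \<and> fst w + snd w *\<^sub>R h \<in> U \<and> 0 < snd w"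
    using eventually_nhds_in_open[OF lip(1,2)]
    by (intro eventually_conj eventually_compose_filterlim[OF _ filterlim_fst_F]
        eventually_compose_filterlim[OF _ filterlim_step_F]
        eventually_compose_filterlim[OF eventually_at_right_less filterlim_snd_F])
  then have bound: "\<forall>\<^sub>F w in F. \<bar>(f (fst w + snd w *\<^sub>R h) - f (fst w)) / snd w\<bar> \<le> L * norm h"
  proof (rule eventually_mono, clarify)
    fix y t assume "fst (y, t) \<in> U" "fst (y, t) + snd (y, t) *\<^sub>R h \<in> U" "0 < snd (y, t :: real)"
    then show "\<bar>(f (fst (y, t) + snd (y, t) *\<^sub>R h) - f (fst (y, t))) / snd (y, t)\<bar> \<le> L * norm h"
      using lipschitz_onD[OF lip(3), of "y + t *\<^sub>R h" y]
      by (simp add: dist_norm abs_divide field_simps)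
  qed
  \<comment> \<open>The lower bound rests on this, since the limit superior along \<open>bot\<close>
    is minus infinity.\<close>
  have "F \<noteq> bot" by (simp add: prod_filter_eq_bot)
  then show "ereal (- (L * norm h)) \<le> clarke_dd f x h"
    unfolding clarke_dd_def case_prod_beta
    by (rule le_Limsup) (rule eventually_mono[OF bound], simp only: ereal_less_eq abs_le_iff, linarith)
  show "clarke_dd f x h \<le> ereal (L * norm h)"
    unfolding clarke_dd_def case_prod_beta
    by (rule Limsup_bounded) (rule eventually_mono[OF bound], simp only: ereal_less_eq abs_le_iff)
qed

lemma ereal_real_clarke_dd: "ereal (real_of_ereal (clarke_dd f x h)) = clarke_dd f x h"
  using clarke_dd_bounds[of h] by (cases "clarke_dd f x h") auto

lemma real_clarke_dd_le: "real_of_ereal (clarke_dd f x h) \<le> L * norm h"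
  using clarke_dd_bounds(2)[of h] by (metis ereal_less_eq(3) ereal_real_clarke_dd)

text \<open>Homogeneity comes from substituting \<open>c * t\<close> for \<open>t\<close>.
  Subadditivity comes from shifting the base point \<open>y\<close> to
  \<open>y + t *\<^sub>R h\<close>, which still tends to \<open>x\<close>.\<close>

lemma sublinear_clarke_dd: "sublinear (\<lambda>h. real_of_ereal (clarke_dd f x h))"
proof (rule sublinearI)
  show "real_of_ereal (clarke_dd f x 0) = 0"
    using clarke_dd_bounds[of 0] by (simp add: order_antisym flip: zero_ereal_def)
next
  fix c :: real and h assume c: "0 < c"
  let ?g = "\<lambda>(y, t). ereal ((f (y + t *\<^sub>R h) - f y) / t)"
  have "filterlim (\<lambda>w. (fst w, c * snd w)) F F"
    using c by (intro filterlim_Pair filterlim_fst_F filterlim_times_pos[OF filterlim_snd_F]) auto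
  from Limsup_compose_le[OF this, of ?g]
  have le: "Limsup F (\<lambda>w. ?g (fst w, c * snd w)) \<le> clarke_dd f x h"
    by (simp add: clarke_dd_def)
  have "clarke_dd f x (c *\<^sub>R h) = Limsup F (\<lambda>w. ereal c * ?g (fst w, c * snd w))"
    unfolding clarke_dd_def using c
    by (intro arg_cong2[where f = Limsup] refl ext) (auto simp: ac_simps)
  also have "\<dots> = ereal c * Limsup F (\<lambda>w. ?g (fst w, c * snd w))"
    using c by (intro Limsup_ereal_mult_left) (auto simp: prod_filter_eq_bot)
  also have "\<dots> \<le> ereal c * clarke_dd f x h"
    using c le by (intro ereal_mult_left_mono) auto
  finally have "ereal (real_of_ereal (clarke_dd f x (c *\<^sub>R h)))
      \<le> ereal c * ereal (real_of_ereal (clarke_dd f x h))"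
    by (simp only: ereal_real_clarke_dd)
  then show "real_of_ereal (clarke_dd f x (c *\<^sub>R h)) \<le> c * real_of_ereal (clarke_dd f x h)"
    by simp
next
  fix h k
  let ?g = "\<lambda>h w. (f (fst w + snd w *\<^sub>R h) - f (fst w)) / snd w"
  let ?r = "\<lambda>h. real_of_ereal (clarke_dd f x h)"
  have dd: "ereal (?r h) = Limsup F (\<lambda>w. ereal (?g h w))" for h
    unfolding ereal_real_clarke_dd by (simp add: clarke_dd_def case_prod_unfold)
  have step: "filterlim (\<lambda>w. (fst w + snd w *\<^sub>R h, snd w)) F F"
    by (intro filterlim_Pair filterlim_step_F filterlim_snd_F)
  have "?r (h + k) \<le> ?r h + ?r k + e" if "0 < e" for e
  proof -
    have "\<forall>\<^sub>F w in F. ereal (?g h w) < ereal (?r h + e / 2)"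
      "\<forall>\<^sub>F w in F. ereal (?g k w) < ereal (?r k + e / 2)"
      using that by (intro Limsup_lessD; unfold dd[symmetric]; simp)+
    moreover from this(2)
    have "\<forall>\<^sub>F w in F. ereal (?g k (fst w + snd w *\<^sub>R h, snd w)) < ereal (?r k + e / 2)"
      using step unfolding filterlim_iff by blast
    ultimately have "\<forall>\<^sub>F w in F. ereal (?g (h + k) w) \<le> ereal (?r h + ?r k + e)"
    proof eventually_elim
      case (elim w)
      \<comment> \<open>The quotient telescopes through the intermediate point
        \<open>y + t *\<^sub>R h\<close>.\<close>
      have "?g (h + k) w = ?g h w + ?g k (fst w + snd w *\<^sub>R h, snd w)"
        by (simp add: scaleR_add_right add.assoc diff_divide_distrib)
      then show ?case using elim by simp
    qed
    then have "ereal (?r (h + k)) \<le> ereal (?r h + ?r k + e)"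
      unfolding dd by (rule Limsup_bounded)
    then show ?thesis by simp
  qed
  then show "?r (h + k) \<le> ?r h + ?r k" by (rule field_le_epsilon)
qed

lemma clarke_gradient_eq_dominated:
  "clarke_gradient f x = dominated (\<lambda>h. real_of_ereal (clarke_dd f x h))"
  unfolding clarke_gradient_def dominated_def
  by (metis ereal_less_eq(3) ereal_real_clarke_dd)

end

section \<open>Duality between the gradient and the directional derivative on a set\<close>

lemma sublinear_SUP:
  assumes "A \<noteq> {}" "\<And>y. y \<in> A \<Longrightarrow> sublinear (P y)" and lub: "\<And>h c. p h \<le> c \<longleftrightarrow> (\<forall>y\<in>A. P y h \<le> c)"
  shows "sublinear p"
proof (rule sublinearI)
  have P_le: "P y h \<le> p h" if "y \<in> A" for y h
    using lub[of h "p h"] that by simp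
  show "p 0 = 0"
    using assms P_le[of _ 0] sublinear_0 by (metis all_not_in_conv order_antisym order_refl)
  show "p (x + y) \<le> p x + p y" for x y
    unfolding lub using assms(2) P_le by (meson add_mono order_trans sublinear_add)
  show "p (c *\<^sub>R x) \<le> c * p x" if "0 < c" for c x
    unfolding lub using assms(2) P_le that by (auto simp: sublinear_scale)
qed

text \<open>\<open>N\<close> is the neighbourhood of \<open>A\<close> and \<open>U\<close> the open
  set inside it; \<open>is_arg_min\<close> includes membership in the set. Everything reduces to
  \<open>dominated p\<close>, with \<open>p\<close> the real-valued form of
  \<open>dd_on f A\<close>.\<close>

theorem proposition3p2:
  fixes f :: "'a::banach \<Rightarrow> real" and A U N :: "'a set" and L :: real
  assumes "A \<noteq> {}"
    and "open U" and "A \<subseteq> U" and "U \<subseteq> N"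
    and "L-lipschitz_on N f"
  shows "(\<exists>a'. is_arg_min norm (\<lambda>a. a \<in> gradient_on f A) a' \<and>
            (INF h\<in>cball 0 1. dd_on f A h) = ereal (- norm a'))
    \<and> (\<forall>a' h'. is_arg_min norm (\<lambda>a. a \<in> gradient_on f A) a' \<and>
            is_arg_min (dd_on f A) (\<lambda>h. h \<in> cball 0 1) h' \<longrightarrow>
            - norm a' = blinfun_apply a' h' \<and> ereal (blinfun_apply a' h') = dd_on f A h')
    \<and> (reflexive_space TYPE('a) \<longrightarrow>
         (\<exists>a' h'. is_arg_min norm (\<lambda>a. a \<in> gradient_on f A) a' \<and>
            is_arg_min (dd_on f A) (\<lambda>h. h \<in> cball 0 1) h'))"
proof -
  let ?P = "\<lambda>y h. real_of_ereal (clarke_dd f y h)"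
  define p where "p h = real_of_ereal (dd_on f A h)" for h
  have L: "0 \<le> L" using assms(5) by (rule lipschitz_on_nonneg)
  have lip: "open U" "y \<in> U" "L-lipschitz_on U f" if "y \<in> A" for y
    using assms that by (auto intro: lipschitz_on_subset)
  note P = sublinear_clarke_dd[OF lip] real_clarke_dd_le[OF lip]
  \<comment> \<open>The upper bound is uniform in \<open>y\<close>, and one point of
    \<open>A\<close> keeps the supremum above minus infinity.\<close>
  have dd: "dd_on f A h = ereal (p h)" for h
  proof -
    obtain y where y: "y \<in> A" using assms(1) by auto
    have "dd_on f A h \<le> ereal (L * norm h)"
      unfolding dd_on_def by (intro SUP_least clarke_dd_bounds(2)[OF lip])
    moreover have "ereal (- (L * norm h)) \<le> dd_on f A h"
      unfolding dd_on_def using clarke_dd_bounds(1)[OF lip[OF y]] y by (rule SUP_upper2[rotated])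
    ultimately show ?thesis unfolding p_def by (cases "dd_on f A h") auto
  qed
  have lub: "p h \<le> c \<longleftrightarrow> (\<forall>y\<in>A. ?P y h \<le> c)" for h c
  proof -
    have "p h \<le> c \<longleftrightarrow> dd_on f A h \<le> ereal c" by (simp add: dd)
    also have "\<dots> \<longleftrightarrow> (\<forall>y\<in>A. clarke_dd f y h \<le> ereal c)"
      by (simp add: dd_on_def SUP_le_iff)
    also have "\<dots> \<longleftrightarrow> (\<forall>y\<in>A. ?P y h \<le> c)"
      by (metis ereal_less_eq(3) ereal_real_clarke_dd[OF lip])
    finally show ?thesis .
  qed
  have "gradient_on f A = weak_star_topology closure_of (convex hull (\<Union>y\<in>A. dominated (?P y)))"
    unfolding gradient_on_def using clarke_gradient_eq_dominated[OF lip] by simp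
  also have "\<dots> = dominated p"
    by (rule weak_star_closure_convex_hull_dominated[OF assms(1) P L lub])
  finally have grad: "gradient_on f A = dominated p" .
  have sub: "sublinear p" by (rule sublinear_SUP[OF assms(1) P(1) lub])
  have p_le: "p h \<le> L * norm h" for h using lub P(2) by blast
  obtain a where a: "a \<in> dominated p"
    and glb: "\<And>c. (\<And>h. h \<in> cball 0 1 \<Longrightarrow> c \<le> p h) \<Longrightarrow> c \<le> - norm a"
    using dominated_minimal_norm[OF sub p_le L] by blast
  have ge: "- norm b \<le> p h" if "b \<in> dominated p" "h \<in> cball 0 1" for b h
    using blinfun_cball_ge[OF that(2), of b] that(1)
    by (auto simp: dominated_def intro: order_trans)
  have min: "norm a \<le> norm b" if "b \<in> dominated p" for b
    using glb[of "- norm b"] ge[OF that] by simp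
  have arg_a: "is_arg_min norm (\<lambda>a. a \<in> gradient_on f A) b \<longleftrightarrow> b \<in> dominated p \<and> norm b = norm a" for b
    using a min by (auto simp: is_arg_min_linorder grad intro: order_antisym)
  \<comment> \<open>The value at a minimiser is a lower bound of \<open>p\<close> on the ball, so
    \<open>glb\<close> applies to it.\<close>
  have arg_h: "is_arg_min (dd_on f A) (\<lambda>h. h \<in> cball 0 1) k \<longleftrightarrow> k \<in> cball 0 1 \<and> p k = - norm a" for k
    using glb[of "p k"] ge[OF a] by (force simp: is_arg_min_linorder dd)
  have inf: "(INF h\<in>cball 0 1. dd_on f A h) = ereal (- norm a)" (is "?I = _")
  proof (rule antisym)
    show "ereal (- norm a) \<le> ?I"
      using ge[OF a] by (intro INF_greatest) (simp add: dd)
    have lower: "?I \<le> ereal (p h)" if "h \<in> cball 0 1" for h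
      using INF_lower[OF that, of "dd_on f A"] by (simp add: dd)
    \<comment> \<open>The bound \<open>glb\<close> concerns real numbers, hence the case split; the
      value at 0 excludes plus infinity.\<close>
    show "?I \<le> ereal (- norm a)"
    proof (cases ?I)
      case (real r)
      then show ?thesis using glb[of r] lower by simp
    next
      case PInf
      then show ?thesis using lower[of 0] by simp
    qed simp
  qed
  \<comment> \<open>Both ends of \<open>- norm b \<le> blinfun_apply b k \<le> p k\<close> equal
    \<open>- norm a\<close>.\<close>
  have "- norm b = blinfun_apply b k \<and> ereal (blinfun_apply b k) = dd_on f A k"
    if "b \<in> dominated p" "norm b = norm a" "k \<in> cball 0 1" "p k = - norm a" for b k
  proof -
    have "blinfun_apply b k \<le> p k" using that(1) by (simp add: dominated_def)
    then show ?thesis using blinfun_cball_ge[OF that(3), of b] that by (simp add: dd)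
  qed
  moreover have "\<exists>k. k \<in> cball 0 1 \<and> p k = - norm a" if refl: "reflexive_space TYPE('a)"
  proof -
    \<comment> \<open>One direction \<open>k\<close> serves all functionals in
      \<open>dominated p\<close>; as one of them attains \<open>p k\<close>, it follows that
      \<open>p k \<le> - norm a\<close>.\<close>
    obtain k where k: "k \<in> cball 0 1" "\<And>b. b \<in> dominated p \<Longrightarrow> blinfun_apply b k \<le> - norm a"
      using reflexive_separation_from_ball[OF refl convex_dominated _ min] a by blast
    obtain b where "b \<in> dominated p" "blinfun_apply b k = p k"
      using dominated_attains[OF sub p_le] .
    then show ?thesis using k(2)[of b] ge[OF a k(1)] k(1) by (auto intro: order_antisym)
  qed
  ultimately show ?thesis
    unfolding arg_a arg_h inf using a by blast
qed

end
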